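(* Let $k\ge0$ be an even integer and let $u:\mathbb{R}^2\to\mathbb{R}$ be a smooth function. For each mesh size $\Delta x=\Delta y=h>0$ let $x_i=ih$, $y_j=jh$ ($i,j\in\mathbb{Z}$) and suppose we are given a piecewise polynomial $R(x,y)=\sum_{i,j}R_{i,j}(x,y)\chi_{i,j}(x,y)$, where $$R_{i,j}(x,y)=\sum_{|\ell|=0}^k\frac{R_{i,j}^{(\ell)}}{\ell_1!\,\ell_2!}(x-x_i)^{\ell_1}(y-y_j)^{\ell_2},\qquad \ell=(\ell_1,\ell_2),\ |\ell|=\ell_1+\ell_2,$$ is a polynomial of total degree at most $k$ with real coefficients $R_{i,j}^{(\ell)}$ and $\chi_{i,j}$ is the characteristic function of the cell $I_{i,j}=[x_i-\frac h2,x_i+\frac h2]\times[y_j-\frac h2,y_j+\frac h2]$. Define the sets of multi-indices $$A=\{\ell:\ |\ell|\text{ even},\ 0\le|\ell|\le k\},$$ $$B=\{\ell:\ \ell_1\text{ odd},\ \ell_2\text{ even},\ 0\le|\ell|\le k\},\qquad C=\{\ell:\ \ell_1\text{ even},\ \ell_2\text{ odd},\ 0\le|\ell|\le k\},$$ write $u_{i,j}^{(\ell)}=\partial_x^{\ell_1}\partial_y^{\ell_2}u(x_i,y_j)$, and suppose that for all $i,j$ $$u_{i,j}^{(\ell)}=R_{i,j}^{(\ell)}+\mathcal{O}(h^{k+2-|\ell|}),\quad \ell\in A,$$ $$u_{i,j}^{(\ell)}-u_{i+1,j}^{(\ell)}=R_{i,j}^{(\ell)}-R_{i+1,j}^{(\ell)}+\mathcal{O}(h^{k+2-|\ell|}),\quad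 \ell\in B,$$ $$u_{i,j}^{(\ell)}-u_{i,j+1}^{(\ell)}=R_{i,j}^{(\ell)}-R_{i,j+1}^{(\ell)}+\mathcal{O}(h^{k+2-|\ell|}),\quad \ell\in C.$$ Then for any $\theta,\eta\in[0,1)$ the reconstruction $Q_{i+\theta,j+\eta}$ is a $(k+2)$-th order approximation of the sliding average of $u$ at $(x_i+\theta h,\,y_j+\eta h)$: $$Q_{i+\theta,j+\eta}=\bar u(x_i+\theta h,\,y_j+\eta h)+\mathcal{O}(h^{k+2}).$$
   Context: The two-dimensional sliding average is $\bar u(x,y)=\frac1{\Delta x\Delta y}\int_{y-\Delta y/2}^{y+\Delta y/2}\int_{x-\Delta x/2}^{x+\Delta x/2}u(x',y')\,dx'\,dy'$, with $\Delta x=\Delta y=h$. For $\theta,\eta\in[0,1)$ the reconstruction is the average of $R$ over the shifted cell centred at $(x_i+\theta h,y_j+\eta h)$: $$Q_{i+\theta,j+\eta}=\frac1{h^2}\int_{y_j+\eta h-h/2}^{y_j+\eta h+h/2}\int_{x_i+\theta h-h/2}^{x_i+\theta h+h/2}R(x,y)\,dx\,dy .$$ Equivalently, $$Q_{i+\theta,j+\eta}=\sum_{|\ell|=0}^k h^{|\ell|}\Big(\alpha_{\ell_1}(\theta)\alpha_{\ell_2}(\eta)R_{i,j}^{(\ell)}+\beta_{\ell_1}(\theta)\alpha_{\ell_2}(\eta)R_{i+1,j}^{(\ell)}+\alpha_{\ell_1}(\theta)\beta_{\ell_2}(\eta)R_{i,j+1}^{(\ell)}+\beta_{\ell_1}(\theta)\beta_{\ell_2}(\eta)R_{i+1,j+1}^{(\ell)}\Big)$$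 with $\alpha_m(\theta)=\frac{1-(2\theta-1)^{m+1}}{2^{m+1}(m+1)!}$ and $\beta_m(\theta)=\frac{(2\theta-1)^{m+1}-(-1)^{m+1}}{2^{m+1}(m+1)!}$. The $\mathcal{O}$ symbols refer to $h\to0$, with implied constants uniform over the indices $(i,j)$ for which $(x_i,y_j)$ lies in any fixed bounded set. *)

theory Defs
  imports "HOL-Analysis.Analysis" "HOL-Library.Landau_Symbols"
begin

definition partial_x :: "(real \<times> real \<Rightarrow> real) \<Rightarrow> real \<times> real \<Rightarrow> real" where
  "partial_x u = (\<lambda>(x, y). deriv (\<lambda>s. u (s, y)) x)"

definition partial_y :: "(real \<times> real \<Rightarrow> real) \<Rightarrow> real \<times> real \<Rightarrow> real" where
  "partial_y u = (\<lambda>(x, y). deriv (\<lambda>t. u (x, t)) y)"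

definition partial :: "nat \<times> nat \<Rightarrow> (real \<times> real \<Rightarrow> real) \<Rightarrow> real \<times> real \<Rightarrow> real" where
  "partial l u = (partial_x ^^ fst l) ((partial_y ^^ snd l) u)"

text \<open>
  The class \<open>C\<^sup>n\<close> on the plane: all partial derivatives up to order \<open>n\<close>, taken in any
  order, exist and are continuous.  The existence clauses are needed because \<^const>\<open>deriv\<close>
  is unspecified at points of non-differentiability.
\<close>

primrec C_class :: "nat \<Rightarrow> (real \<times> real \<Rightarrow> real) \<Rightarrow> bool" where
  "C_class 0 u \<longleftrightarrow> continuous_on UNIV u"
| "C_class (Suc n) u \<longleftrightarrow>
     continuous_on UNIV u \<and>
     (\<forall>x y. (\<lambda>s. u (s, y)) differentiable (at x)) \<and>
     (\<forall>x y. (\<lambda>t. u (x, t)) differentiable (at y)) \<and>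
     C_class n (partial_x u) \<and> C_class n (partial_y u)"

definition smooth :: "(real \<times> real \<Rightarrow> real) \<Rightarrow> bool" where
  "smooth u \<longleftrightarrow> (\<forall>n. C_class n u)"

definition node :: "real \<Rightarrow> int \<Rightarrow> int \<Rightarrow> real \<times> real" where
  "node h i j = (of_int i * h, of_int j * h)"

definition cell :: "real \<Rightarrow> int \<Rightarrow> int \<Rightarrow> (real \<times> real) set" where
  "cell h i j = {of_int i * h - h / 2 .. of_int i * h + h / 2}
              \<times> {of_int j * h - h / 2 .. of_int j * h + h / 2}"

definition deg :: "nat \<times> nat \<Rightarrow> nat" where
  "deg l = fst l + snd l"

text \<open>
  A coefficient family \<open>c\<close> gives the number \<open>R\<^bsub>i,j\<^esub>\<^bsup>(l)\<^esup>\<close> for mesh size \<open>h\<close> as \<open>c h i j l\<close>.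
\<close>

type_synonym coeffs = "real \<Rightarrow> int \<Rightarrow> int \<Rightarrow> nat \<times> nat \<Rightarrow> real"

definition local_poly :: "nat \<Rightarrow> coeffs \<Rightarrow> real \<Rightarrow> int \<Rightarrow> int \<Rightarrow> real \<times> real \<Rightarrow> real" where
  "local_poly k c h i j = (\<lambda>(x, y).
     \<Sum>l\<in>{l. deg l \<le> k}. c h i j l / (fact (fst l) * fact (snd l))
        * (x - of_int i * h) ^ fst l * (y - of_int j * h) ^ snd l)"

text \<open>
  At every point only finitely many (at most four, on shared cell boundaries) summands are
  nonzero, so the unordered infinite sum is a finite one.
\<close>

definition piecewise_poly :: "nat \<Rightarrow> coeffs \<Rightarrow> real \<Rightarrow> real \<times> real \<Rightarrow> real" where
  "piecewise_poly k c h p =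
     (\<Sum>\<^sub>\<infinity>(i, j)\<in>UNIV. local_poly k c h i j p * indicator (cell h i j) p)"

definition sliding_avg ::
    "real \<Rightarrow> real \<Rightarrow> (real \<times> real \<Rightarrow> real) \<Rightarrow> real \<times> real \<Rightarrow> real" where
  "sliding_avg dx dy u = (\<lambda>(x, y). 1 / (dx * dy) *
     integral {y - dy / 2 .. y + dy / 2} (\<lambda>y'.
       integral {x - dx / 2 .. x + dx / 2} (\<lambda>x'. u (x', y'))))"

definition shifted_node :: "real \<Rightarrow> int \<Rightarrow> int \<Rightarrow> real \<Rightarrow> real \<Rightarrow> real \<times> real" where
  "shifted_node h i j \<theta> \<eta> = (of_int i * h + \<theta> * h, of_int j * h + \<eta> * h)"

definition reconstruction ::
    "nat \<Rightarrow> coeffs \<Rightarrow> real \<Rightarrow> int \<Rightarrow> int \<Rightarrow> real \<Rightarrow> real \<Rightarrow> real" where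
  "reconstruction k c h i j \<theta> \<eta> =
     sliding_avg h h (piecewise_poly k c h) (shifted_node h i j \<theta> \<eta>)"

definition index_A :: "nat \<Rightarrow> (nat \<times> nat) set" where
  "index_A k = {l. even (deg l) \<and> deg l \<le> k}"

definition index_B :: "nat \<Rightarrow> (nat \<times> nat) set" where
  "index_B k = {l. odd (fst l) \<and> even (snd l) \<and> deg l \<le> k}"

definition index_C :: "nat \<Rightarrow> (nat \<times> nat) set" where
  "index_C k = {l. even (fst l) \<and> odd (snd l) \<and> deg l \<le> k}"

text \<open>
  The limit \<open>h \<rightarrow> 0\<close>, \<open>h > 0\<close>, uniformly over the indices whose node lies in \<open>S\<close>.
\<close>

definition mesh_filter :: "(real \<times> real) set \<Rightarrow> (real \<times> int \<times> int) filter" where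
  "mesh_filter S = inf (filtercomap fst (at_right 0)) (principal {(h, i, j). node h i j \<in> S})"

lemma eventually_mesh_filter:
  "eventually P (mesh_filter S) \<longleftrightarrow>
     (\<exists>h0>0. \<forall>h i j. 0 < h \<and> h < h0 \<and> node h i j \<in> S \<longrightarrow> P (h, i, j))"
proof
  assume "eventually P (mesh_filter S)"
  then obtain Q where Q: "eventually Q (at_right (0::real))"
      "\<And>h i j. Q h \<Longrightarrow> node h i j \<in> S \<Longrightarrow> P (h, i, j)"
    unfolding mesh_filter_def eventually_inf_principal eventually_filtercomap by auto
  then obtain b where "b > 0" "\<And>h. 0 < h \<Longrightarrow> h < b \<Longrightarrow> Q h"
    unfolding eventually_at_right_field by auto
  with Q(2) show "\<exists>h0>0. \<forall>h i j. 0 < h \<and> h < h0 \<and> node h i j \<in> S \<longrightarrow> P (h, i, j)"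
    by blast
next
  assume "\<exists>h0>0. \<forall>h i j. 0 < h \<and> h < h0 \<and> node h i j \<in> S \<longrightarrow> P (h, i, j)"
  then obtain b where b: "b > 0" "\<And>h i j. 0 < h \<Longrightarrow> h < b \<Longrightarrow> node h i j \<in> S \<Longrightarrow> P (h, i, j)"
    by blast
  have "eventually (\<lambda>h. 0 < h \<and> h < b) (at_right (0::real))"
    unfolding eventually_at_right_field using b(1) by auto
  then show "eventually P (mesh_filter S)"
    unfolding mesh_filter_def eventually_inf_principal eventually_filtercomap
    using b(2) by (intro exI[of _ "\<lambda>h. 0 < h \<and> h < b"]) auto
qed

text \<open>
  \<open>f (h, i, j) = g (h, i, j) + O(h\<^sup>n)\<close> as \<open>h \<rightarrow> 0\<close>, with a constant uniform over the indices
  with nodes in any fixed bounded set.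
\<close>

definition eq_up_to_order ::
    "nat \<Rightarrow> (real \<Rightarrow> int \<Rightarrow> int \<Rightarrow> real) \<Rightarrow> (real \<Rightarrow> int \<Rightarrow> int \<Rightarrow> real) \<Rightarrow> bool" where
  "eq_up_to_order n f g \<longleftrightarrow>
     (\<forall>S. bounded S \<longrightarrow> (\<lambda>(h, i, j). f h i j - g h i j) \<in> O[mesh_filter S](\<lambda>(h, i, j). h ^ n))"

lemma eq_up_to_order_iff:
  "eq_up_to_order n f g \<longleftrightarrow>
     (\<forall>S. bounded S \<longrightarrow> (\<exists>C>0. \<exists>h0>0. \<forall>h i j. 0 < h \<and> h < h0 \<and> node h i j \<in> S \<longrightarrow>
        \<bar>f h i j - g h i j\<bar> \<le> C * h ^ n))"
  unfolding eq_up_to_order_def bigo_def eventually_mesh_filter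
  by (simp add: power_abs)

end

theory Submission
  imports Defs
begin

text \<open>
  The shifted cell meets four cells.  On each of the four pieces \<open>R\<close> is a single polynomial, and
  \<open>u\<close> is, up to \<open>O(h\<^bsup>k+2\<^esup>)\<close>, its Taylor polynomial of degree \<open>k + 1\<close> at the corresponding node.
  Hence the error is a sum over \<open>deg l \<le> k + 1\<close> of products of one-dimensional moments with the
  coefficient errors \<open>R\<^sup>(\<^sup>l\<^sup>) - u\<^sup>(\<^sup>l\<^sup>)\<close> at four nodes, where \<open>R\<^sup>(\<^sup>l\<^sup>) = 0\<close> for \<open>deg l = k + 1\<close>.
  For \<open>deg l\<close> even each coefficient error is small.  For \<open>deg l\<close> odd one component of \<open>l\<close> is odd, the two
  moments in that direction are opposite, and only differences of coefficient errors between
  neighbouring nodes remain; for \<open>deg l = k + 1\<close>, odd because \<open>k\<close> is even, these are differences of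
  derivatives of \<open>u\<close>, which gain a factor \<open>h\<close>.
\<close>

section \<open>Taylor expansion of smooth functions of two variables\<close>

lemma smooth_continuous: "smooth u \<Longrightarrow> continuous_on UNIV u"
  unfolding smooth_def by (metis C_class.simps(1))

lemma smooth_partial_x: "smooth u \<Longrightarrow> smooth (partial_x u)"
  unfolding smooth_def by (metis C_class.simps(2))

lemma smooth_partial_y: "smooth u \<Longrightarrow> smooth (partial_y u)"
  unfolding smooth_def by (metis C_class.simps(2))

lemma smooth_DERIV_x:
  assumes "smooth u"
  shows "((\<lambda>s. u (s, y)) has_real_derivative partial_x u (x, y)) (at x)"
proof -
  have "C_class (Suc 0) u" using assms unfolding smooth_def by blast
  then have "(\<lambda>s. u (s, y)) differentiable (at x)" by simp
  then show ?thesis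
    unfolding partial_x_def by (simp add: DERIV_deriv_iff_real_differentiable)
qed

lemma smooth_DERIV_y:
  assumes "smooth u"
  shows "((\<lambda>t. u (x, t)) has_real_derivative partial_y u (x, y)) (at y)"
proof -
  have "C_class (Suc 0) u" using assms unfolding smooth_def by blast
  then have "(\<lambda>t. u (x, t)) differentiable (at y)" by simp
  then show ?thesis
    unfolding partial_y_def by (simp add: DERIV_deriv_iff_real_differentiable)
qed

lemma smooth_partial: "smooth u \<Longrightarrow> smooth (partial l u)"
proof -
  assume u: "smooth u"
  have y: "smooth ((partial_y ^^ n) u)" for n
    by (induction n) (auto simp: u smooth_partial_y)
  have "smooth ((partial_x ^^ m) ((partial_y ^^ n) u))" for m n
    by (induction m) (auto simp: y smooth_partial_x)
  then show ?thesis unfolding partial_def .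
qed

lemma partial_Suc_fst: "partial (Suc p, m) u = partial_x (partial (p, m) u)"
  by (simp add: partial_def)

lemma partial_Suc_snd: "partial (0, Suc m) u = partial_y (partial (0, m) u)"
  by (simp add: partial_def)

lemma partial_zero: "partial (0, 0) u = u"
  by (simp add: partial_def)

text \<open>Compactness of the square is what makes the constants of the Taylor estimates uniform
  over all base points in a bounded set.\<close>

lemma continuous_bounded_square:
  fixes v :: "real \<times> real \<Rightarrow> real"
  assumes "continuous_on UNIV v"
  obtains B where "B \<ge> 0" "\<And>x y. \<bar>x\<bar> \<le> r \<Longrightarrow> \<bar>y\<bar> \<le> r \<Longrightarrow> \<bar>v (x, y)\<bar> \<le> B"
proof -
  have "compact (v ` ({-r..r} \<times> {-r..r}))"
    by (intro compact_continuous_image compact_Times continuous_on_subset[OF assms]) auto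
  then obtain B where B: "\<And>z. z \<in> v ` ({-r..r} \<times> {-r..r}) \<Longrightarrow> norm z \<le> B"
    using compact_imp_bounded bounded_iff by metis
  show ?thesis
  proof (rule that[of "max B 0"])
    fix x y :: real assume "\<bar>x\<bar> \<le> r" "\<bar>y\<bar> \<le> r"
    then have "(x, y) \<in> {-r..r} \<times> {-r..r}" by auto
    then show "\<bar>v (x, y)\<bar> \<le> max B 0" using B by fastforce
  qed simp
qed

text \<open>Lagrange form of the remainder, with \<open>diff m\<close> in the role of the m-th
  derivative. The intermediate point lies between \<open>c\<close> and \<open>x\<close>, hence in
  [-r, r], where \<open>B\<close> bounds the next derivative.\<close>

lemma Taylor_bound:
  fixes diff :: "nat \<Rightarrow> real \<Rightarrow> real"
  assumes D: "\<And>m t. (diff m has_real_derivative diff (Suc m) t) (at t)"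
    and B: "\<And>t. \<bar>t\<bar> \<le> r \<Longrightarrow> \<bar>diff (Suc n) t\<bar> \<le> B" "B \<ge> 0"
    and "\<bar>x\<bar> \<le> r" "\<bar>c\<bar> \<le> r" "\<bar>x - c\<bar> \<le> h"
  shows "\<bar>diff 0 x - (\<Sum>m\<le>n. diff m c / fact m * (x - c) ^ m)\<bar> \<le> B * h ^ Suc n"
proof (cases "x = c")
  case True
  then have "(\<Sum>m\<le>n. diff m c / fact m * (x - c) ^ m) = diff 0 x"
    by (simp add: sum.atMost_shift)
  moreover have "0 \<le> B * h ^ Suc n" using assms by auto
  ultimately show ?thesis by simp
next
  case False
  have "\<exists>t. (if x < c then x < t \<and> t < c else c < t \<and> t < x) \<and>
      diff 0 x = (\<Sum>m<Suc n. diff m c / fact m * (x - c) ^ m)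
        + diff (Suc n) t / fact (Suc n) * (x - c) ^ Suc n"
    by (rule Taylor[where a = "-r" and b = r]) (use assms False in auto)
  then obtain t where t': "if x < c then x < t \<and> t < c else c < t \<and> t < x"
    and t: "diff 0 x - (\<Sum>m\<le>n. diff m c / fact m * (x - c) ^ m)
       = diff (Suc n) t / fact (Suc n) * (x - c) ^ Suc n"
    unfolding lessThan_Suc_atMost by auto
  have tr: "\<bar>t\<bar> \<le> r" using t' assms(4,5) by (auto split: if_splits)
  \<comment> \<open>The factorial of the Lagrange remainder is at least 1 and is dropped.\<close>
  have "\<bar>diff (Suc n) t\<bar> / fact (Suc n) \<le> B / 1"
    by (rule frac_le) (use B tr fact_ge_1[of "Suc n"] in \<open>auto simp del: fact_Suc\<close>)
  moreover have "\<bar>x - c\<bar> ^ Suc n \<le> h ^ Suc n"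
    by (rule power_mono) (use assms in auto)
  ultimately have "\<bar>diff (Suc n) t\<bar> / fact (Suc n) * \<bar>x - c\<bar> ^ Suc n \<le> B * h ^ Suc n"
    by (intro mult_mono) (use B in auto)
  then show ?thesis unfolding t by (simp add: abs_mult power_abs)
qed

lemma finite_deg_le: "finite {l. deg l \<le> n}"
  by (rule finite_subset[of _ "{..n} \<times> {..n}"]) (auto simp: deg_def)

text \<open>An expansion in y followed by an expansion of each coefficient in x produces the
  right-hand side, sliced by the order \<open>m\<close> in y. Exchanging the two components turns it
  into the triangle of multi-indices.\<close>

lemma sum_deg_le:
  "(\<Sum>l\<in>{l. deg l \<le> n}. f (fst l) (snd l)) = (\<Sum>m\<le>n. \<Sum>p\<le>n - m. f p m)"
proof -
  have "(\<Sum>m\<le>n. \<Sum>p\<le>n - m. f p m) = (\<Sum>(m, p)\<in>Sigma {..n} (\<lambda>m. {..n - m}). f p m)"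
    by (rule sum.Sigma) auto
  also have "\<dots> = (\<Sum>l\<in>{l. deg l \<le> n}. f (fst l) (snd l))"
    by (rule sum.reindex_bij_witness[of _ prod.swap prod.swap]) (auto simp: deg_def)
  finally show ?thesis by simp
qed

text \<open>Kept in the shape of \<open>local_poly\<close>, so that at a node it is a
  \<open>local_poly\<close> whose coefficients are the derivatives of \<open>u\<close>.\<close>

definition taylor_poly ::
    "nat \<Rightarrow> (real \<times> real \<Rightarrow> real) \<Rightarrow> real \<times> real \<Rightarrow> real \<times> real \<Rightarrow> real" where
  "taylor_poly n u = (\<lambda>(a, b) (x, y).
     \<Sum>l\<in>{l. deg l \<le> n}. partial l u (a, b) / (fact (fst l) * fact (snd l))
        * (x - a) ^ fst l * (y - b) ^ snd l)"

lemma taylor_poly_0: "taylor_poly 0 u p q = u p"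
proof -
  have "{l. deg l \<le> 0} = {(0, 0)}" by (auto simp: deg_def)
  then show ?thesis by (simp add: taylor_poly_def partial_zero split_def)
qed

text \<open>
  Expanding first in \<open>y\<close> and then in \<open>x\<close> produces the derivatives exactly in the order fixed
  by \<^const>\<open>partial\<close>, so the symmetry of mixed derivatives plays no role.
\<close>

lemma Taylor_bound_2:
  assumes u: "smooth u"
  shows "\<exists>K. \<forall>a b x y h. \<bar>a\<bar> \<le> r \<longrightarrow> \<bar>b\<bar> \<le> r \<longrightarrow> \<bar>x\<bar> \<le> r \<longrightarrow> \<bar>y\<bar> \<le> r \<longrightarrow>
    \<bar>x - a\<bar> \<le> h \<longrightarrow> \<bar>y - b\<bar> \<le> h \<longrightarrow> \<bar>u (x, y) - taylor_poly n u (a, b) (x, y)\<bar> \<le> K * h ^ Suc n"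
proof -
  have "\<exists>B\<ge>0. \<forall>x y. \<bar>x\<bar> \<le> r \<longrightarrow> \<bar>y\<bar> \<le> r \<longrightarrow> \<bar>partial l u (x, y)\<bar> \<le> B" for l
    by (rule continuous_bounded_square[OF smooth_continuous[OF smooth_partial[OF u]], of r l]) blast
  then obtain B where B: "\<And>l. B l \<ge> 0"
    "\<And>l x y. \<bar>x\<bar> \<le> r \<Longrightarrow> \<bar>y\<bar> \<le> r \<Longrightarrow> \<bar>partial l u (x, y)\<bar> \<le> B l"
    by metis
  \<comment> \<open>The first summand bounds the remainder in y. The coefficient of (y - b)^m is
    then expanded in x to degree n - m only: its remainder, of size h^(n-m+1), is multiplied by at
    most h^m and so again has size h^(n+1).\<close>
  define K where "K = B (0, Suc n) + (\<Sum>m\<le>n. B (Suc (n - m), m))"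
  show ?thesis
  proof (rule exI[of _ K], intro allI impI)
    fix a b x y h :: real
    assume bds: "\<bar>a\<bar> \<le> r" "\<bar>b\<bar> \<le> r" "\<bar>x\<bar> \<le> r" "\<bar>y\<bar> \<le> r" "\<bar>x - a\<bar> \<le> h" "\<bar>y - b\<bar> \<le> h"
    then have h: "h \<ge> 0" by linarith
    have "\<bar>partial (0, 0) u (x, y) - (\<Sum>m\<le>n. partial (0, m) u (x, b) / fact m * (y - b) ^ m)\<bar>
        \<le> B (0, Suc n) * h ^ Suc n"
    proof (rule Taylor_bound[where diff = "\<lambda>m t. partial (0, m) u (x, t)" and r = r])
      show "((\<lambda>t. partial (0, m) u (x, t)) has_real_derivative partial (0, Suc m) u (x, t)) (at t)"
        for m t unfolding partial_Suc_snd by (rule smooth_DERIV_y[OF smooth_partial[OF u]])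
    qed (use B bds in auto)
    then have ey: "\<bar>u (x, y) - (\<Sum>m\<le>n. partial (0, m) u (x, b) / fact m * (y - b) ^ m)\<bar>
        \<le> B (0, Suc n) * h ^ Suc n" unfolding partial_zero .
    have ex: "\<bar>partial (0, m) u (x, b)
          - (\<Sum>p\<le>n - m. partial (p, m) u (a, b) / fact p * (x - a) ^ p)\<bar>
        \<le> B (Suc (n - m), m) * h ^ Suc (n - m)" for m
    proof (rule Taylor_bound[where diff = "\<lambda>p t. partial (p, m) u (t, b)" and r = r])
      show "((\<lambda>t. partial (p, m) u (t, b)) has_real_derivative partial (Suc p, m) u (t, b)) (at t)"
        for p t unfolding partial_Suc_fst by (rule smooth_DERIV_x[OF smooth_partial[OF u]])
    qed (use B bds in auto)
    define E where "E m = partial (0, m) u (x, b)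
          - (\<Sum>p\<le>n - m. partial (p, m) u (a, b) / fact p * (x - a) ^ p)" for m
    have Em: "\<bar>E m / fact m * (y - b) ^ m\<bar> \<le> B (Suc (n - m), m) * h ^ Suc n" if "m \<le> n" for m
    proof -
      have "\<bar>E m\<bar> / fact m \<le> (B (Suc (n - m), m) * h ^ Suc (n - m)) / 1"
        by (rule frac_le) (use ex[of m] B(1) h in \<open>auto simp: E_def\<close>)
      moreover have "\<bar>y - b\<bar> ^ m \<le> h ^ m"
        by (rule power_mono) (use bds in auto)
      ultimately have "\<bar>E m\<bar> / fact m * \<bar>y - b\<bar> ^ m
          \<le> (B (Suc (n - m), m) * h ^ Suc (n - m)) * h ^ m"
        by (intro mult_mono) (use B(1) h in auto)
      also have "\<dots> = B (Suc (n - m), m) * h ^ Suc n"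
        using that by (simp flip: power_add)
      finally show ?thesis by (simp add: abs_mult power_abs)
    qed
    let ?T = "taylor_poly n u (a, b) (x, y)"
    have "?T = (\<Sum>m\<le>n. \<Sum>p\<le>n - m. partial (p, m) u (a, b) / (fact p * fact m)
          * (x - a) ^ p * (y - b) ^ m)"
      using sum_deg_le[of "\<lambda>p m. partial (p, m) u (a, b) / (fact p * fact m)
          * (x - a) ^ p * (y - b) ^ m" n]
      by (simp add: taylor_poly_def)
    also have "\<dots> = (\<Sum>m\<le>n. (\<Sum>p\<le>n - m. partial (p, m) u (a, b) / fact p * (x - a) ^ p)
          / fact m * (y - b) ^ m)"
      by (simp add: sum_distrib_left sum_divide_distrib mult_ac)
    finally have "(\<Sum>m\<le>n. partial (0, m) u (x, b) / fact m * (y - b) ^ m) - ?T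
        = (\<Sum>m\<le>n. E m / fact m * (y - b) ^ m)"
      by (simp add: E_def diff_divide_distrib left_diff_distrib flip: sum_subtractf)
    moreover have "\<bar>\<Sum>m\<le>n. E m / fact m * (y - b) ^ m\<bar>
        \<le> (\<Sum>m\<le>n. B (Suc (n - m), m) * h ^ Suc n)"
      by (rule order.trans[OF sum_abs]) (intro sum_mono Em, simp)
    ultimately show "\<bar>u (x, y) - ?T\<bar> \<le> K * h ^ Suc n"
      using ey unfolding K_def by (simp add: distrib_right sum_distrib_right)
  qed
qed

section \<open>Iterated integrals\<close>

definition iterated_integral ::
    "real \<Rightarrow> real \<Rightarrow> real \<Rightarrow> real \<Rightarrow> (real \<times> real \<Rightarrow> real) \<Rightarrow> real" where
  "iterated_integral a b c d f = integral {c..d} (\<lambda>y. integral {a..b} (\<lambda>x. f (x, y)))"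

lemma sliding_avg_iterated:
  "sliding_avg dx dy u (x, y) = 1 / (dx * dy) *
     iterated_integral (x - dx / 2) (x + dx / 2) (y - dy / 2) (y + dy / 2) u"
  by (simp add: sliding_avg_def iterated_integral_def)

lemma continuous_on_row:
  fixes f :: "real \<times> real \<Rightarrow> real"
  assumes "continuous_on UNIV f"
  shows "continuous_on T (\<lambda>x. f (x, y))"
  by (rule continuous_on_compose2[OF assms]) (auto intro!: continuous_intros)

lemma continuous_on_inner_integral:
  fixes f :: "real \<times> real \<Rightarrow> real"
  assumes "continuous_on UNIV f"
  shows "continuous_on T (\<lambda>y. integral {a..b} (\<lambda>x. f (x, y)))"
proof -
  have "continuous_on (T \<times> cbox a b) (\<lambda>(y, x). f (x, y))"
    unfolding split_def
    by (rule continuous_on_compose2[OF assms]) (auto intro!: continuous_intros)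
  from integral_continuous_on_param[OF this] show ?thesis by simp
qed

lemma iterated_integral_diff:
  assumes "continuous_on UNIV f" "continuous_on UNIV g"
  shows "iterated_integral a b c d (\<lambda>p. f p - g p)
    = iterated_integral a b c d f - iterated_integral a b c d g"
  unfolding iterated_integral_def using assms
  by (simp add: Henstock_Kurzweil_Integration.integral_diff integrable_continuous_real
      continuous_on_row continuous_on_inner_integral)

lemma iterated_integral_bound:
  assumes f: "continuous_on UNIV f" and "a \<le> b" "c \<le> d"
    and "\<And>x y. x \<in> {a..b} \<Longrightarrow> y \<in> {c..d} \<Longrightarrow> \<bar>f (x, y)\<bar> \<le> B"
  shows "\<bar>iterated_integral a b c d f\<bar> \<le> B * (b - a) * (d - c)"
proof -
  have "norm (integral {a..b} (\<lambda>x. f (x, y))) \<le> B * (b - a)" if "y \<in> {c..d}" for y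
    using assms(2,4) that by (intro integral_bound continuous_on_row[OF f]) auto
  then have "norm (iterated_integral a b c d f) \<le> B * (b - a) * (d - c)"
    unfolding iterated_integral_def
    using assms(3) by (intro integral_bound[OF _ continuous_on_inner_integral[OF f]])
  then show ?thesis by simp
qed

text \<open>The values of \<open>F\<close> matter only on the open pieces, because finitely many
  points do not affect an integral. This suits \<open>piecewise_poly\<close>, which on a cell edge
  adds the polynomials of all cells meeting there.\<close>

lemma integral_two_pieces:
  fixes F f g :: "real \<Rightarrow> real"
  assumes "a \<le> b" "b \<le> c" and f: "continuous_on {a..b} f" and g: "continuous_on {b..c} g"
    and Ff: "\<And>x. a < x \<Longrightarrow> x < b \<Longrightarrow> F x = f x" and Fg: "\<And>x. b < x \<Longrightarrow> x < c \<Longrightarrow> F x = g x"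
  shows "integral {a..c} F = integral {a..b} f + integral {b..c} g"
proof -
  have "(F has_integral integral {a..b} f) {a..b}"
    by (rule has_integral_spike_finite[where S = "{a, b}" and f = f])
      (use f Ff in \<open>auto intro!: integrable_integral integrable_continuous_real simp: less_le\<close>)
  moreover have "(F has_integral integral {b..c} g) {b..c}"
    by (rule has_integral_spike_finite[where S = "{b, c}" and f = g])
      (use g Fg in \<open>auto intro!: integrable_integral integrable_continuous_real simp: less_le\<close>)
  ultimately show ?thesis
    using has_integral_combine[OF assms(1,2)] by (blast intro: integral_unique)
qed

text \<open>Two-piece splitting is applied in x on every row off the interfaces, then in y; the rows
  at \<open>y1\<close>, \<open>y2\<close> and \<open>y3\<close> are again finitely many exceptions.
  The first argument of \<open>f\<close> tells left from right, the second lower from upper.\<close>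

lemma iterated_integral_four_pieces:
  fixes f :: "bool \<Rightarrow> bool \<Rightarrow> real \<times> real \<Rightarrow> real"
  assumes x: "x1 \<le> x2" "x2 \<le> x3" and y: "y1 \<le> y2" "y2 \<le> y3"
    and f: "\<And>s t. continuous_on UNIV (f s t)"
    and F: "\<And>x y. x1 < x \<Longrightarrow> x < x2 \<Longrightarrow> y1 < y \<Longrightarrow> y < y2 \<Longrightarrow> F (x, y) = f False False (x, y)"
      "\<And>x y. x2 < x \<Longrightarrow> x < x3 \<Longrightarrow> y1 < y \<Longrightarrow> y < y2 \<Longrightarrow> F (x, y) = f True False (x, y)"
      "\<And>x y. x1 < x \<Longrightarrow> x < x2 \<Longrightarrow> y2 < y \<Longrightarrow> y < y3 \<Longrightarrow> F (x, y) = f False True (x, y)"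
      "\<And>x y. x2 < x \<Longrightarrow> x < x3 \<Longrightarrow> y2 < y \<Longrightarrow> y < y3 \<Longrightarrow> F (x, y) = f True True (x, y)"
  shows "iterated_integral x1 x3 y1 y3 F =
     iterated_integral x1 x2 y1 y2 (f False False) + iterated_integral x2 x3 y1 y2 (f True False)
   + iterated_integral x1 x2 y2 y3 (f False True) + iterated_integral x2 x3 y2 y3 (f True True)"
proof -
  define G where "G t y = integral {x1..x2} (\<lambda>x. f False t (x, y))
      + integral {x2..x3} (\<lambda>x. f True t (x, y))" for t y
  have G: "continuous_on T (G t)" for T t
    unfolding G_def by (intro continuous_on_add continuous_on_inner_integral f)
  have "integral {x1..x3} (\<lambda>x. F (x, y)) = G False y" if "y1 < y" "y < y2" for y
    unfolding G_def
    by (rule integral_two_pieces) (use x that F in \<open>auto intro!: continuous_on_row f\<close>)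
  moreover have "integral {x1..x3} (\<lambda>x. F (x, y)) = G True y" if "y2 < y" "y < y3" for y
    unfolding G_def
    by (rule integral_two_pieces) (use x that F in \<open>auto intro!: continuous_on_row f\<close>)
  ultimately have "iterated_integral x1 x3 y1 y3 F
      = integral {y1..y2} (G False) + integral {y2..y3} (G True)"
    unfolding iterated_integral_def using y by (intro integral_two_pieces G) auto
  then show ?thesis
    unfolding G_def iterated_integral_def
    by (simp add: Henstock_Kurzweil_Integration.integral_add integrable_continuous_real
        continuous_on_inner_integral f)
qed

text \<open>This is the integral of t^p from \<open>a\<close> to \<open>b\<close>. Over the two
  parts of the shifted interval, from \<theta>h - h/2 to h/2 and from -h/2 to \<theta>h - h/2, it
  equals p! h^(p+1) times \<alpha>_p(\<theta>) and \<beta>_p(\<theta>) respectively.\<close>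

definition moment :: "nat \<Rightarrow> real \<Rightarrow> real \<Rightarrow> real" where
  "moment p a b = (b ^ Suc p - a ^ Suc p) / Suc p"

lemma has_integral_moment:
  assumes "a \<le> b"
  shows "((\<lambda>x. (x - c) ^ p) has_integral moment p (a - c) (b - c)) {a..b}"
proof -
  have "((\<lambda>x. (x - c) ^ Suc p / Suc p) has_real_derivative (x - c) ^ p) (at x within {a..b})" for x
    by (auto intro!: derivative_eq_intros simp del: power_Suc of_nat_Suc)
  then have "((\<lambda>x. (x - c) ^ p) has_integral
      ((b - c) ^ Suc p / Suc p - (a - c) ^ Suc p / Suc p)) {a..b}"
    by (intro fundamental_theorem_of_calculus[OF assms])
      (auto simp: has_real_derivative_iff_has_vector_derivative)
  then show ?thesis by (simp only: moment_def diff_divide_distrib)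
qed

lemma moment_bound:
  assumes "\<bar>a\<bar> \<le> h / 2" "\<bar>b\<bar> \<le> h / 2"
  shows "\<bar>moment p a b\<bar> \<le> h ^ Suc p"
proof -
  have h: "h \<ge> 0" using assms by linarith
  have "\<bar>a\<bar> ^ Suc p \<le> (h / 2) ^ Suc p" "\<bar>b\<bar> ^ Suc p \<le> (h / 2) ^ Suc p"
    by (intro power_mono; use assms in simp)+
  then have "\<bar>b ^ Suc p - a ^ Suc p\<bar> \<le> 2 * (h / 2) ^ Suc p"
    unfolding power_abs[symmetric] by linarith
  also have "\<dots> = h * (h / 2) ^ p" by simp
  also have "\<dots> \<le> h * h ^ p"
    by (intro mult_left_mono power_mono) (use h in auto)
  also have "\<dots> = h ^ Suc p" by simp
  finally have "\<bar>b ^ Suc p - a ^ Suc p\<bar> / Suc p \<le> h ^ Suc p / 1"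
    by (intro frac_le) (use h in auto)
  then show ?thesis unfolding moment_def by simp
qed

text \<open>The antiderivative of an odd power is even and ignores the sign of \<open>a\<close>.
  With \<open>a\<close> = h/2 and \<open>b\<close> = \<theta>h - h/2 the moments of the two parts of
  the shifted interval are therefore opposite.\<close>

lemma moment_odd: "odd p \<Longrightarrow> moment p (- a) b = - moment p b a"
  unfolding moment_def by (simp add: field_simps)

section \<open>Integrals of local polynomials, and the piecewise polynomial inside a cell\<close>

lemma continuous_local_poly: "continuous_on UNIV (local_poly n c h i j)"
  unfolding local_poly_def split_def by (intro continuous_intros)

lemma iterated_integral_local_poly:
  assumes "a \<le> b" "c \<le> d"
  shows "iterated_integral a b c d (local_poly n C h i j) =
    (\<Sum>l\<in>{l. deg l \<le> n}. C h i j l / (fact (fst l) * fact (snd l))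
       * moment (fst l) (a - of_int i * h) (b - of_int i * h)
       * moment (snd l) (c - of_int j * h) (d - of_int j * h))"
proof -
  have "integral {a..b} (\<lambda>x. local_poly n C h i j (x, y)) =
      (\<Sum>l\<in>{l. deg l \<le> n}. C h i j l / (fact (fst l) * fact (snd l))
         * moment (fst l) (a - of_int i * h) (b - of_int i * h) * (y - of_int j * h) ^ snd l)" for y
    unfolding local_poly_def split_conv
    by (intro integral_unique has_integral_sum finite_deg_le has_integral_mult_left
        has_integral_mult_right has_integral_moment assms)
  then show ?thesis
    unfolding iterated_integral_def
    by (simp only:) (intro integral_unique has_integral_sum finite_deg_le has_integral_mult_left
        has_integral_mult_right has_integral_moment assms)
qed

text \<open>Two centres within h/2 of \<open>x\<close>, one of them strictly, are less than h apart,
  and centres are integer multiples of h. Strictness excludes the cell edges.\<close>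

lemma cell_index_unique:
  fixes h x :: real
  assumes "0 < h" "\<bar>x - of_int i * h\<bar> < h / 2" "\<bar>x - of_int i' * h\<bar> \<le> h / 2"
  shows "i' = i"
proof -
  have "\<bar>of_int (i' - i) * h\<bar> < h"
    using assms(2,3) unfolding of_int_diff left_diff_distrib by linarith
  then have "\<bar>of_int (i' - i) :: real\<bar> < 1" using assms(1) by (simp add: abs_mult)
  then show ?thesis by linarith
qed

text \<open>An interior point lies in no other cell, so the infinite sum collapses to a single
  summand.\<close>

lemma piecewise_poly_interior:
  assumes "0 < h" "\<bar>x - of_int i * h\<bar> < h / 2" "\<bar>y - of_int j * h\<bar> < h / 2"
  shows "piecewise_poly k c h (x, y) = local_poly k c h i j (x, y)"
proof -
  have *: "(x, y) \<in> cell h i' j' \<longleftrightarrow> i' = i \<and> j' = j" for i' j'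
  proof
    assume "(x, y) \<in> cell h i' j'"
    then have "of_int i' * h - h / 2 \<le> x \<and> x \<le> of_int i' * h + h / 2"
      "of_int j' * h - h / 2 \<le> y \<and> y \<le> of_int j' * h + h / 2"
      unfolding cell_def by auto
    then have "\<bar>x - of_int i' * h\<bar> \<le> h / 2" "\<bar>y - of_int j' * h\<bar> \<le> h / 2"
      by linarith+
    then show "i' = i \<and> j' = j" using cell_index_unique assms by blast
  next
    assume "i' = i \<and> j' = j"
    moreover have "of_int i * h - h / 2 \<le> x \<and> x \<le> of_int i * h + h / 2"
      "of_int j * h - h / 2 \<le> y \<and> y \<le> of_int j * h + h / 2"
      using assms by linarith+
    ultimately show "(x, y) \<in> cell h i' j'" by (auto simp: cell_def)
  qed
  have "piecewise_poly k c h (x, y)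
      = (\<Sum>\<^sub>\<infinity>(i', j')\<in>{(i, j)}. local_poly k c h i' j' (x, y) * indicator (cell h i' j') (x, y))"
    unfolding piecewise_poly_def
    by (rule infsum_cong_neutral) (auto simp: * indicator_def)
  then show ?thesis by (simp add: *)
qed

section \<open>Quantities of a given order\<close>

text \<open>Comparison with zero turns the relation into membership in a Landau class for each
  bounded set of nodes, so that sums and products are covered by the rules for big-O.\<close>

abbreviation of_order :: "nat \<Rightarrow> (real \<Rightarrow> int \<Rightarrow> int \<Rightarrow> real) \<Rightarrow> bool" where
  "of_order n f \<equiv> eq_up_to_order n f (\<lambda>h i j. 0)"

lemma eq_up_to_order_iff_of_order:
  "eq_up_to_order n f g \<longleftrightarrow> of_order n (\<lambda>h i j. f h i j - g h i j)"
  by (simp add: eq_up_to_order_def)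

text \<open>Every bounded set lies in a square around the origin, and the threshold 1 for h may be
  used throughout. \<open>C\<close> may have any sign; \<open>max C 1\<close> restores
  positivity.\<close>

lemma of_orderI:
  assumes "\<And>r. \<exists>C. \<forall>h i j. 0 < h \<longrightarrow> h < 1 \<longrightarrow> \<bar>of_int i * h\<bar> \<le> r \<longrightarrow> \<bar>of_int j * h\<bar> \<le> r \<longrightarrow>
      \<bar>f h i j\<bar> \<le> C * h ^ n"
  shows "of_order n f"
  unfolding eq_up_to_order_iff
proof (intro allI impI)
  fix S :: "(real \<times> real) set" assume "bounded S"
  then obtain r where r: "\<And>p. p \<in> S \<Longrightarrow> norm p \<le> r" by (auto simp: bounded_iff)
  obtain C where C: "\<And>h i j. 0 < h \<Longrightarrow> h < 1 \<Longrightarrow> \<bar>of_int i * h\<bar> \<le> r \<Longrightarrow> \<bar>of_int j * h\<bar> \<le> r \<Longrightarrow>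
      \<bar>f h i j\<bar> \<le> C * h ^ n"
    using assms[of r] by blast
  have "\<bar>f h i j - 0\<bar> \<le> max C 1 * h ^ n" if "0 < h" "h < 1" "node h i j \<in> S" for h i j
  proof -
    have "norm (node h i j) \<le> r" using r that by blast
    then have "\<bar>of_int i * h\<bar> \<le> r" "\<bar>of_int j * h\<bar> \<le> r"
      unfolding node_def
      using norm_fst_le[of "of_int i * h" "of_int j * h"] norm_snd_le[of "of_int j * h" "of_int i * h"]
      unfolding real_norm_def by linarith+
    then have "\<bar>f h i j\<bar> \<le> C * h ^ n" using C that by blast
    also have "\<dots> \<le> max C 1 * h ^ n" using that by (intro mult_right_mono) auto
    finally show ?thesis by simp
  qed
  then show "\<exists>C>0. \<exists>h0>0. \<forall>h i j. 0 < h \<and> h < h0 \<and> node h i j \<in> S \<longrightarrow>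
      \<bar>f h i j - 0\<bar> \<le> C * h ^ n"
    by (intro exI[of _ "max C 1"] conjI exI[of _ 1]) auto
qed

lemma of_orderE:
  assumes "of_order n f" "bounded S"
  obtains C h0 where "C > 0" "h0 > 0"
    "\<And>h i j. 0 < h \<Longrightarrow> h < h0 \<Longrightarrow> node h i j \<in> S \<Longrightarrow> \<bar>f h i j\<bar> \<le> C * h ^ n"
  using assms(1)[unfolded eq_up_to_order_iff, rule_format, OF assms(2)] that by auto

lemma of_order_add:
  "of_order n f \<Longrightarrow> of_order n g \<Longrightarrow> of_order n (\<lambda>h i j. f h i j + g h i j)"
  unfolding eq_up_to_order_def split_def by (auto intro: sum_in_bigo)

lemma of_order_diff:
  "of_order n f \<Longrightarrow> of_order n g \<Longrightarrow> of_order n (\<lambda>h i j. f h i j - g h i j)"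
  unfolding eq_up_to_order_def split_def by (auto intro: sum_in_bigo)

lemma of_order_sum:
  "(\<And>l. l \<in> L \<Longrightarrow> of_order n (f l)) \<Longrightarrow> of_order n (\<lambda>h i j. \<Sum>l\<in>L. f l h i j)"
  unfolding eq_up_to_order_def split_def by (auto intro: big_sum_in_bigo)

lemma of_order_mult:
  "of_order m f \<Longrightarrow> of_order n g \<Longrightarrow> of_order (m + n) (\<lambda>h i j. f h i j * g h i j)"
  unfolding eq_up_to_order_def split_def power_add by (auto intro: landau_o.big.mult)

lemma of_order_const: "of_order 0 (\<lambda>h i j. c)"
  by (rule of_orderI, rule exI[of _ "\<bar>c\<bar>"]) simp

lemma of_order_divide_square:
  assumes "of_order (n + 2) f"
  shows "of_order n (\<lambda>h i j. f h i j / (h * h))"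
  unfolding eq_up_to_order_iff
proof (intro allI impI)
  fix S :: "(real \<times> real) set" assume "bounded S"
  then obtain C h0 where C: "C > 0" "h0 > 0"
    "\<And>h i j. 0 < h \<Longrightarrow> h < h0 \<Longrightarrow> node h i j \<in> S \<Longrightarrow> \<bar>f h i j\<bar> \<le> C * h ^ (n + 2)"
    by (rule of_orderE[OF assms]) blast
  have "\<bar>f h i j / (h * h) - 0\<bar> \<le> C * h ^ n" if "0 < h" "h < h0" "node h i j \<in> S" for h i j
    using C(3)[OF that] that by (simp add: abs_mult pos_divide_le_eq power_add power2_eq_square mult_ac)
  then show "\<exists>C>0. \<exists>h0>0. \<forall>h i j. 0 < h \<and> h < h0 \<and> node h i j \<in> S \<longrightarrow>
      \<bar>f h i j / (h * h) - 0\<bar> \<le> C * h ^ n"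
    using C(1,2) by blast
qed

text \<open>For h < 1 a neighbouring node is at distance at most 2, so the bound on a ball of radius
  r + 2 serves for the shifted indices.\<close>

lemma of_order_shift:
  assumes "of_order n f" "\<bar>a\<bar> \<le> 1" "\<bar>b\<bar> \<le> 1"
  shows "of_order n (\<lambda>h i j. f h (i + a) (j + b))"
  unfolding eq_up_to_order_iff
proof (intro allI impI)
  fix S :: "(real \<times> real) set" assume S: "bounded S"
  obtain r where r: "\<And>p. p \<in> S \<Longrightarrow> norm p \<le> r" using S by (auto simp: bounded_iff)
  obtain C h0 where C: "C > 0" "h0 > 0"
    "\<And>h i j. 0 < h \<Longrightarrow> h < h0 \<Longrightarrow> node h i j \<in> cball 0 (r + 2) \<Longrightarrow> \<bar>f h i j\<bar> \<le> C * h ^ n"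
    by (rule of_orderE[OF assms(1) bounded_cball]) blast
  have "node h (i + a) (j + b) \<in> cball 0 (r + 2)" if "0 < h" "h < 1" "node h i j \<in> S" for h i j
  proof -
    have "\<bar>of_int a\<bar> * \<bar>h\<bar> \<le> 1" "\<bar>of_int b\<bar> * \<bar>h\<bar> \<le> 1"
      by (intro mult_le_one; use assms(2,3) that in simp)+
    then have "norm (of_int a * h, of_int b * h) \<le> 1 + 1"
      by (intro order.trans[OF norm_Pair_le]) (simp add: abs_mult)
    moreover have "node h (i + a) (j + b) = node h i j + (of_int a * h, of_int b * h)"
      by (simp add: node_def distrib_right)
    ultimately show ?thesis
      using r[OF that(3)] norm_triangle_ineq[of "node h i j" "(of_int a * h, of_int b * h)"] by simp
  qed
  then show "\<exists>C>0. \<exists>h0>0. \<forall>h i j. 0 < h \<and> h < h0 \<and> node h i j \<in> S \<longrightarrow>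
      \<bar>f h (i + a) (j + b) - 0\<bar> \<le> C * h ^ n"
    using C by (intro exI[of _ C] conjI exI[of _ "min h0 1"]) auto
qed

lemma of_order_moment:
  assumes "\<And>h. h > 0 \<Longrightarrow> \<bar>a h\<bar> \<le> h / 2" "\<And>h. h > 0 \<Longrightarrow> \<bar>b h\<bar> \<le> h / 2"
  shows "of_order (Suc p) (\<lambda>h i j. moment p (a h) (b h))"
proof (rule of_orderI)
  have "\<bar>moment p (a h) (b h)\<bar> \<le> 1 * h ^ Suc p" if "0 < h" for h
    using moment_bound assms[OF that] by simp
  then show "\<exists>C. \<forall>h i j. 0 < h \<longrightarrow> h < 1 \<longrightarrow> \<bar>of_int i * h\<bar> \<le> r \<longrightarrow> \<bar>of_int j * h\<bar> \<le> r \<longrightarrow>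
      \<bar>moment p (a h) (b h)\<bar> \<le> C * h ^ Suc p" for r
    by blast
qed

text \<open>The Taylor estimate of degree 0 is a local Lipschitz bound. Applied to derivatives of
  order k + 1 it supplies the extra factor h.\<close>

lemma of_order_node_diff:
  assumes v: "smooth v" and "\<bar>a\<bar> \<le> 1" "\<bar>b\<bar> \<le> 1"
  shows "of_order 1 (\<lambda>h i j. v (node h i j) - v (node h (i + a) (j + b)))"
proof (rule of_orderI)
  fix r :: real
  obtain K where K: "\<forall>a b x y h. \<bar>a\<bar> \<le> r + 1 \<longrightarrow> \<bar>b\<bar> \<le> r + 1 \<longrightarrow> \<bar>x\<bar> \<le> r + 1 \<longrightarrow>
      \<bar>y\<bar> \<le> r + 1 \<longrightarrow> \<bar>x - a\<bar> \<le> h \<longrightarrow> \<bar>y - b\<bar> \<le> h \<longrightarrow>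
      \<bar>v (x, y) - taylor_poly 0 v (a, b) (x, y)\<bar> \<le> K * h ^ Suc 0"
    using Taylor_bound_2[OF v, of "r + 1" 0] ..
  have "\<bar>v (node h i j) - v (node h (i + a) (j + b))\<bar> \<le> K * h ^ 1"
    if h: "0 < h" "h < 1" and r: "\<bar>of_int i * h\<bar> \<le> r" "\<bar>of_int j * h\<bar> \<le> r" for h i j
  proof -
    have "\<bar>of_int a\<bar> * h \<le> 1 * h" "\<bar>of_int b\<bar> * h \<le> 1 * h"
      by (intro mult_right_mono; use assms(2,3) h in simp)+
    then have "\<bar>of_int a * h\<bar> \<le> h" "\<bar>of_int b * h\<bar> \<le> h"
      using h by (simp_all add: abs_mult)
    moreover have "of_int (i + a) * h = of_int i * h + of_int a * h"
      "of_int (j + b) * h = of_int j * h + of_int b * h"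
      by (simp_all add: distrib_right)
    ultimately have "\<bar>of_int (i + a) * h\<bar> \<le> r + 1" "\<bar>of_int (j + b) * h\<bar> \<le> r + 1"
      "\<bar>of_int i * h - of_int (i + a) * h\<bar> \<le> h" "\<bar>of_int j * h - of_int (j + b) * h\<bar> \<le> h"
      using h r by linarith+
    then have "\<bar>v (of_int i * h, of_int j * h) - v (of_int (i + a) * h, of_int (j + b) * h)\<bar>
        \<le> K * h ^ Suc 0"
      using K[rule_format, of "of_int (i + a) * h" "of_int (j + b) * h" "of_int i * h" "of_int j * h" h]
        r unfolding taylor_poly_0 by linarith
    then show ?thesis by (simp add: node_def)
  qed
  then show "\<exists>C. \<forall>h i j. 0 < h \<longrightarrow> h < 1 \<longrightarrow> \<bar>of_int i * h\<bar> \<le> r \<longrightarrow> \<bar>of_int j * h\<bar> \<le> r \<longrightarrow>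
      \<bar>v (node h i j) - v (node h (i + a) (j + b))\<bar> \<le> C * h ^ 1"
    by blast
qed

lemma of_order_cong:
  assumes "\<And>h i j. 0 < h \<Longrightarrow> f h i j = g h i j" "of_order n g"
  shows "of_order n f"
  using assms(2) by (simp add: eq_up_to_order_iff assms(1) cong: conj_cong)

lemma of_order_uminus: "of_order n f \<Longrightarrow> of_order n (\<lambda>h i j. - f h i j)"
  by (simp add: eq_up_to_order_iff)

text \<open>The remainder has size h^(n+1) on the cell, and the rectangle of integration, a part of
  that cell, has area at most h^2.\<close>

lemma of_order_iterated_integral_taylor:
  assumes u: "smooth u"
    and ab: "\<And>h. h > 0 \<Longrightarrow> - (h / 2) \<le> a h \<and> a h \<le> b h \<and> b h \<le> h / 2"
    and cd: "\<And>h. h > 0 \<Longrightarrow> - (h / 2) \<le> c h \<and> c h \<le> d h \<and> d h \<le> h / 2"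
  shows "of_order (n + 3) (\<lambda>h i j. iterated_integral (of_int i * h + a h) (of_int i * h + b h)
    (of_int j * h + c h) (of_int j * h + d h) (\<lambda>p. u p - taylor_poly n u (node h i j) p))"
proof (rule of_orderI)
  fix r :: real
  obtain K where K: "\<forall>a b x y h. \<bar>a\<bar> \<le> r + 1 \<longrightarrow> \<bar>b\<bar> \<le> r + 1 \<longrightarrow> \<bar>x\<bar> \<le> r + 1 \<longrightarrow>
      \<bar>y\<bar> \<le> r + 1 \<longrightarrow> \<bar>x - a\<bar> \<le> h \<longrightarrow> \<bar>y - b\<bar> \<le> h \<longrightarrow>
      \<bar>u (x, y) - taylor_poly n u (a, b) (x, y)\<bar> \<le> K * h ^ Suc n"
    using Taylor_bound_2[OF u, of "r + 1" n] ..
  \<comment> \<open>\<open>K\<close> comes without a sign, while bounding the side lengths by h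
    requires a nonnegative factor; hence \<open>max K 0\<close>.\<close>
  have "\<bar>iterated_integral (of_int i * h + a h) (of_int i * h + b h)
      (of_int j * h + c h) (of_int j * h + d h) (\<lambda>p. u p - taylor_poly n u (node h i j) p)\<bar>
      \<le> max K 0 * h ^ (n + 3)"
    if h: "0 < h" "h < 1" and r: "\<bar>of_int i * h\<bar> \<le> r" "\<bar>of_int j * h\<bar> \<le> r" for h i j
  proof -
    have "\<bar>iterated_integral (of_int i * h + a h) (of_int i * h + b h)
        (of_int j * h + c h) (of_int j * h + d h) (\<lambda>p. u p - taylor_poly n u (node h i j) p)\<bar>
        \<le> (max K 0 * h ^ Suc n) * (of_int i * h + b h - (of_int i * h + a h))
           * (of_int j * h + d h - (of_int j * h + c h))"
    proof (rule iterated_integral_bound)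
      show "continuous_on UNIV (\<lambda>p. u p - taylor_poly n u (node h i j) p)"
        unfolding taylor_poly_def split_def
        by (intro continuous_intros smooth_continuous u)
    next
      fix x y
      assume "x \<in> {of_int i * h + a h..of_int i * h + b h}" "y \<in> {of_int j * h + c h..of_int j * h + d h}"
      then have "\<bar>x - of_int i * h\<bar> \<le> h" "\<bar>y - of_int j * h\<bar> \<le> h" "\<bar>x\<bar> \<le> r + 1" "\<bar>y\<bar> \<le> r + 1"
        using ab[OF h(1)] cd[OF h(1)] h r unfolding atLeastAtMost_iff by linarith+
      then have "\<bar>u (x, y) - taylor_poly n u (node h i j) (x, y)\<bar> \<le> K * h ^ Suc n"
        unfolding node_def using K r by simp
      also have "\<dots> \<le> max K 0 * h ^ Suc n"
        using h by (intro mult_right_mono) auto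
      finally show "\<bar>u (x, y) - taylor_poly n u (node h i j) (x, y)\<bar> \<le> max K 0 * h ^ Suc n" .
    qed (use ab[OF h(1)] cd[OF h(1)] in auto)
    also have "\<dots> \<le> (max K 0 * h ^ Suc n) * h * h"
      using ab[OF h(1)] cd[OF h(1)] h
      by (intro mult_mono mult_nonneg_nonneg order.refl) auto
    also have "\<dots> = max K 0 * h ^ (n + 3)"
      by (simp add: power_add power3_eq_cube)
    finally show ?thesis .
  qed
  then show "\<exists>C. \<forall>h i j. 0 < h \<longrightarrow> h < 1 \<longrightarrow> \<bar>of_int i * h\<bar> \<le> r \<longrightarrow> \<bar>of_int j * h\<bar> \<le> r \<longrightarrow>
      \<bar>iterated_integral (of_int i * h + a h) (of_int i * h + b h)
      (of_int j * h + c h) (of_int j * h + d h) (\<lambda>p. u p - taylor_poly n u (node h i j) p)\<bar>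
      \<le> C * h ^ (n + 3)"
    by blast
qed

section \<open>Combining the four cells met by the shifted cell\<close>

lemma taylor_poly_node:
  "taylor_poly n u (node h i j) = local_poly n (\<lambda>h i j l. partial l u (node h i j)) h i j"
  by (simp add: taylor_poly_def local_poly_def node_def)

text \<open>Padding with zero coefficients lets \<open>R\<close> and a Taylor polynomial of higher
  degree be summed over the same multi-indices.\<close>

lemma local_poly_extend:
  assumes "k \<le> n"
  shows "local_poly k c h i j
    = local_poly n (\<lambda>h i j l. if deg l \<le> k then c h i j l else 0) h i j"
  unfolding local_poly_def
  by (intro ext, clarify, rule sum.mono_neutral_cong_left) (use assms finite_deg_le in auto)

text \<open>The Taylor polynomial is inserted between \<open>R\<close> and \<open>u\<close>. Both
  polynomials are centred at the same node, so their difference integrates to moments times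
  coefficient errors; what is left is the integrated Taylor remainder.\<close>

lemma piece_error:
  fixes h :: real and i j :: int
  assumes u: "smooth u" and "a \<le> b" "c \<le> d" "k \<le> n"
  defines "ii \<equiv> iterated_integral (of_int i * h + a) (of_int i * h + b)
    (of_int j * h + c) (of_int j * h + d)"
  shows "ii (local_poly k R h i j) - ii u
    = (\<Sum>l\<in>{l. deg l \<le> n}. 1 / (fact (fst l) * fact (snd l))
         * (moment (fst l) a b * moment (snd l) c d
            * ((if deg l \<le> k then R h i j l else 0) - partial l u (node h i j))))
      - ii (\<lambda>p. u p - taylor_poly n u (node h i j) p)"
proof -
  have "ii (\<lambda>p. u p - taylor_poly n u (node h i j) p) = ii u - ii (taylor_poly n u (node h i j))"
    unfolding ii_def taylor_poly_node
    by (intro iterated_integral_diff smooth_continuous u continuous_local_poly)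
  moreover have "ii (local_poly k R h i j) - ii (taylor_poly n u (node h i j))
      = (\<Sum>l\<in>{l. deg l \<le> n}. 1 / (fact (fst l) * fact (snd l))
         * (moment (fst l) a b * moment (snd l) c d
            * ((if deg l \<le> k then R h i j l else 0) - partial l u (node h i j))))"
    unfolding ii_def taylor_poly_node local_poly_extend[OF \<open>k \<le> n\<close>]
    using assms(2,3)
    by (simp only: iterated_integral_local_poly add_left_mono add_diff_cancel_left'
        flip: sum_subtractf) (simp add: algebra_simps diff_divide_distrib)
  ultimately show ?thesis by simp
qed

text \<open>The number sh - h/2 is the left end of the shifted interval measured from the left node,
  and also its right end measured from the right node. The bounds keep both parts inside their
  cells.\<close>

lemma interface_offset:
  fixes s h :: real
  assumes "s \<in> {0..<1}" "h > 0"
  shows "- (h / 2) \<le> s * h - h / 2" "s * h - h / 2 \<le> h / 2"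
proof -
  have "0 \<le> s * h" "s * h \<le> 1 * h"
    using assms by (intro mult_nonneg_nonneg mult_right_mono; simp)+
  then show "- (h / 2) \<le> s * h - h / 2" "s * h - h / 2 \<le> h / 2" by linarith+
qed

text \<open>
  For odd \<open>p\<close> the moments of the two parts of the shifted interval cancel, so only the
  difference of \<open>D\<close> across the cell interface enters; likewise for odd \<open>q\<close>.
\<close>

lemma of_order_corner_sum:
  fixes \<theta> \<eta> :: real
  assumes \<theta>: "\<theta> \<in> {0..<1}" and \<eta>: "\<eta> \<in> {0..<1}"
    and A: "even (p + q) \<Longrightarrow> of_order e D"
    and B: "odd p \<Longrightarrow> even q \<Longrightarrow> of_order e (\<lambda>h i j. D h i j - D h (i + 1) j)"
    and C: "even p \<Longrightarrow> odd q \<Longrightarrow> of_order e (\<lambda>h i j. D h i j - D h i (j + 1))"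
  shows "of_order (p + q + 2 + e) (\<lambda>h i j.
      moment p (\<theta> * h - h / 2) (h / 2) * moment q (\<eta> * h - h / 2) (h / 2) * D h i j
    + moment p (- (h / 2)) (\<theta> * h - h / 2) * moment q (\<eta> * h - h / 2) (h / 2) * D h (i + 1) j
    + moment p (\<theta> * h - h / 2) (h / 2) * moment q (- (h / 2)) (\<eta> * h - h / 2) * D h i (j + 1)
    + moment p (- (h / 2)) (\<theta> * h - h / 2) * moment q (- (h / 2)) (\<eta> * h - h / 2)
        * D h (i + 1) (j + 1))"
proof -
  define m1 where "m1 h = moment p (\<theta> * h - h / 2) (h / 2)" for h
  define m2 where "m2 h = moment p (- (h / 2)) (\<theta> * h - h / 2)" for h
  define n1 where "n1 h = moment q (\<eta> * h - h / 2) (h / 2)" for h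
  define n2 where "n2 h = moment q (- (h / 2)) (\<eta> * h - h / 2)" for h
  have bounds: "\<bar>s * h - h / 2\<bar> \<le> h / 2" if "s \<in> {0..<1}" "h > 0" for s h :: real
    using interface_offset[OF that] by linarith
  have m: "of_order (Suc p) (\<lambda>h i j. m1 h)" "of_order (Suc p) (\<lambda>h i j. m2 h)"
    unfolding m1_def m2_def by (rule of_order_moment; use bounds[OF \<theta>] in simp)+
  have n: "of_order (Suc q) (\<lambda>h i j. n1 h)" "of_order (Suc q) (\<lambda>h i j. n2 h)"
    unfolding n1_def n2_def by (rule of_order_moment; use bounds[OF \<eta>] in simp)+
  have prod: "of_order (p + q + 2 + e) (\<lambda>h i j. a h * b h * f h i j)"
    if "of_order (Suc p) (\<lambda>h i j. a h)" "of_order (Suc q) (\<lambda>h i j. b h)" "of_order e f" for a b f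
    using of_order_mult[OF of_order_mult[OF that(1,2)] that(3)] by simp
  have "of_order (p + q + 2 + e) (\<lambda>h i j. m1 h * n1 h * D h i j + m2 h * n1 h * D h (i + 1) j
      + m1 h * n2 h * D h i (j + 1) + m2 h * n2 h * D h (i + 1) (j + 1))"
  proof (cases "even (p + q)")
    case True
    have D: "of_order e (\<lambda>h i j. D h (i + a) (j + b))" if "\<bar>a\<bar> \<le> 1" "\<bar>b\<bar> \<le> 1" for a b
      by (rule of_order_shift[OF A[OF True] that])
    have "of_order e (\<lambda>h i j. D h (i + 1) j)" "of_order e (\<lambda>h i j. D h i (j + 1))"
      "of_order e (\<lambda>h i j. D h (i + 1) (j + 1))"
      using D[of 1 0] D[of 0 1] D[of 1 1] by simp_all
    then show ?thesis
      using A[OF True] m n by (intro of_order_add prod)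
  next
    case odd: False
    show ?thesis
    proof (cases "odd p")
      \<comment> \<open>Here \<open>q\<close> is even. The terms are paired across the vertical
        interface, separately in the lower and the upper row; the estimate for the upper row is that
        for the lower one shifted in \<open>j\<close>.\<close>
      case True
      then have B': "of_order e (\<lambda>h i j. D h i j - D h (i + 1) j)" using odd B by simp
      then have B'': "of_order e (\<lambda>h i j. D h i (j + 1) - D h (i + 1) (j + 1))"
        using of_order_shift[OF B', of 0 1] by simp
      have "m2 h = - m1 h" for h unfolding m1_def m2_def by (rule moment_odd[OF True])
      then have "m1 h * n1 h * D h i j + m2 h * n1 h * D h (i + 1) j
          + m1 h * n2 h * D h i (j + 1) + m2 h * n2 h * D h (i + 1) (j + 1)
        = m1 h * n1 h * (D h i j - D h (i + 1) j)
          + m1 h * n2 h * (D h i (j + 1) - D h (i + 1) (j + 1))" for h i j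
        by (simp add: algebra_simps)
      then show ?thesis using of_order_add[OF prod[OF m(1) n(1) B'] prod[OF m(1) n(2) B'']] by simp
    next
      \<comment> \<open>Now \<open>q\<close> is odd, and the pairing is across the horizontal
        interface, column by column.\<close>
      case False
      then have C': "of_order e (\<lambda>h i j. D h i j - D h i (j + 1))" using odd C by simp
      then have C'': "of_order e (\<lambda>h i j. D h (i + 1) j - D h (i + 1) (j + 1))"
        using of_order_shift[OF C', of 1 0] by simp
      have "odd q" using odd False by simp
      then have "n2 h = - n1 h" for h unfolding n1_def n2_def by (rule moment_odd)
      then have "m1 h * n1 h * D h i j + m2 h * n1 h * D h (i + 1) j
          + m1 h * n2 h * D h i (j + 1) + m2 h * n2 h * D h (i + 1) (j + 1)
        = m1 h * n1 h * (D h i j - D h i (j + 1))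
          + m2 h * n1 h * (D h (i + 1) j - D h (i + 1) (j + 1))" for h i j
        by (simp add: algebra_simps)
      then show ?thesis using of_order_add[OF prod[OF m(1) n(1) C'] prod[OF m(2) n(1) C'']] by simp
    qed
  qed
  then show ?thesis unfolding m1_def m2_def n1_def n2_def .
qed

theorem proposition3p1:
  fixes k :: nat and u :: "real \<times> real \<Rightarrow> real" and R :: coeffs and \<theta> \<eta> :: real
  assumes "even k"
    and "smooth u"
    and "\<And>l. l \<in> index_A k \<Longrightarrow> eq_up_to_order (k + 2 - deg l)
           (\<lambda>h i j. partial l u (node h i j))
           (\<lambda>h i j. R h i j l)"
    and "\<And>l. l \<in> index_B k \<Longrightarrow> eq_up_to_order (k + 2 - deg l)
           (\<lambda>h i j. partial l u (node h i j) - partial l u (node h (i + 1) j))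
           (\<lambda>h i j. R h i j l - R h (i + 1) j l)"
    and "\<And>l. l \<in> index_C k \<Longrightarrow> eq_up_to_order (k + 2 - deg l)
           (\<lambda>h i j. partial l u (node h i j) - partial l u (node h i (j + 1)))
           (\<lambda>h i j. R h i j l - R h i (j + 1) l)"
    and "\<theta> \<in> {0..<1}" and "\<eta> \<in> {0..<1}"
  shows "eq_up_to_order (k + 2)
           (\<lambda>h i j. reconstruction k R h i j \<theta> \<eta>)
           (\<lambda>h i j. sliding_avg h h u (shifted_node h i j \<theta> \<eta>))"
proof -

  \<comment> \<open>Orders of the coefficient errors\<close>
  note u = \<open>smooth u\<close>
  \<comment> \<open>Degree k + 1 is included because a Taylor polynomial of degree k would leave an
    error of size h^(k+1), one order too large. The coefficients of \<open>R\<close> there are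
    zero.\<close>
  define D where "D l h i j = (if deg l \<le> k then R h i j l else 0) - partial l u (node h i j)"
    for l h i j
  have DA: "of_order (k + 2 - deg l) (D l)" if "even (deg l)" "deg l \<le> k + 1" for l
  proof -
    \<comment> \<open>As k is even, k + 1 is odd and cannot be an even degree. The minus sign below
      arises since the hypotheses bound u - R and \<open>D\<close> is R - u.\<close>
    have "deg l \<le> k" using that \<open>even k\<close> by (metis Suc_eq_plus1 even_Suc le_SucE)
    then have "of_order (k + 2 - deg l) (\<lambda>h i j. - (partial l u (node h i j) - R h i j l))"
      using assms(3)[of l] that
      by (intro of_order_uminus) (simp add: index_A_def eq_up_to_order_iff_of_order[symmetric])
    then show ?thesis using \<open>deg l \<le> k\<close> by (simp add: D_def[abs_def])
  qed
  have DB: "of_order (k + 2 - deg l) (\<lambda>h i j. D l h i j - D l h (i + 1) j)"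
    if "odd (fst l)" "even (snd l)" "deg l \<le> k + 1" for l
  proof (cases "deg l \<le> k")
    case True
    then have "of_order (k + 2 - deg l) (\<lambda>h i j. -
        (partial l u (node h i j) - partial l u (node h (i + 1) j) - (R h i j l - R h (i + 1) j l)))"
      using assms(4)[of l] that
      by (intro of_order_uminus) (simp add: index_B_def eq_up_to_order_iff_of_order[symmetric])
    then show ?thesis using True by (simp add: D_def algebra_simps)
  next
    case False
    \<comment> \<open>In degree k + 1 the difference involves only derivatives of \<open>u\<close>
      at neighbouring nodes, and smoothness gives the single order required.\<close>
    then have "k + 2 - deg l = 1" using that by simp
    then show ?thesis
      using False of_order_uminus[OF of_order_node_diff[OF smooth_partial[OF u], of 1 0 l]]
      by (simp add: D_def)
  qed
  have DC: "of_order (k + 2 - deg l) (\<lambda>h i j. D l h i j - D l h i (j + 1))"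
    if "even (fst l)" "odd (snd l)" "deg l \<le> k + 1" for l
  proof (cases "deg l \<le> k")
    case True
    then have "of_order (k + 2 - deg l) (\<lambda>h i j. -
        (partial l u (node h i j) - partial l u (node h i (j + 1)) - (R h i j l - R h i (j + 1) l)))"
      using assms(5)[of l] that
      by (intro of_order_uminus) (simp add: index_C_def eq_up_to_order_iff_of_order[symmetric])
    then show ?thesis using True by (simp add: D_def algebra_simps)
  next
    case False
    then have "k + 2 - deg l = 1" using that by simp
    then show ?thesis
      using False of_order_uminus[OF of_order_node_diff[OF smooth_partial[OF u], of 0 1 l]]
      by (simp add: D_def)
  qed

  \<comment> \<open>The contribution of one multi-index, gathered from the four parts of the shifted
    cell before estimating so that cancellation can act.\<close>
  define M where "M l h i j =
      moment (fst l) (\<theta> * h - h / 2) (h / 2) * moment (snd l) (\<eta> * h - h / 2) (h / 2) * D l h i j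
    + moment (fst l) (- (h / 2)) (\<theta> * h - h / 2) * moment (snd l) (\<eta> * h - h / 2) (h / 2)
        * D l h (i + 1) j
    + moment (fst l) (\<theta> * h - h / 2) (h / 2) * moment (snd l) (- (h / 2)) (\<eta> * h - h / 2)
        * D l h i (j + 1)
    + moment (fst l) (- (h / 2)) (\<theta> * h - h / 2) * moment (snd l) (- (h / 2)) (\<eta> * h - h / 2)
        * D l h (i + 1) (j + 1)" for l h i j
  have M: "of_order (k + 4) (M l)" if "deg l \<le> k + 1" for l
  proof -
    have "of_order (fst l + snd l + 2 + (k + 2 - deg l)) (M l)"
      unfolding M_def[abs_def]
      by (rule of_order_corner_sum[OF assms(6,7)]; use DA DB DC that in \<open>simp add: deg_def\<close>)
    \<comment> \<open>The moments contribute deg l + 2 orders, exactly compensating the loss in the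
      coefficient errors. The truncated subtraction is exact because deg l is at most k + 1.\<close>
    moreover have "fst l + snd l + 2 + (k + 2 - deg l) = k + 4"
      using that by (simp add: deg_def)
    ultimately show ?thesis by metis
  qed

  \<comment> \<open>Taylor remainders over the four parts of the shifted cell\<close>
  define E where "E a b c d h i j = iterated_integral (of_int i * h + a) (of_int i * h + b)
      (of_int j * h + c) (of_int j * h + d) (\<lambda>p. u p - taylor_poly (k + 1) u (node h i j) p)"
    for a b c d h i j
  have E: "of_order (k + 4) (\<lambda>h. E (a h) (b h) (c h) (d h) h)"
    if "\<And>h. h > 0 \<Longrightarrow> - (h / 2) \<le> a h \<and> a h \<le> b h \<and> b h \<le> h / 2"
      "\<And>h. h > 0 \<Longrightarrow> - (h / 2) \<le> c h \<and> c h \<le> d h \<and> d h \<le> h / 2" for a b c d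
    using of_order_iterated_integral_taylor[OF u that, where n = "k + 1"]
    unfolding E_def by (simp add: eval_nat_numeral)
  define E4 where "E4 h i j =
      E (\<theta> * h - h / 2) (h / 2) (\<eta> * h - h / 2) (h / 2) h i j
    + E (- (h / 2)) (\<theta> * h - h / 2) (\<eta> * h - h / 2) (h / 2) h (i + 1) j
    + E (\<theta> * h - h / 2) (h / 2) (- (h / 2)) (\<eta> * h - h / 2) h i (j + 1)
    + E (- (h / 2)) (\<theta> * h - h / 2) (- (h / 2)) (\<eta> * h - h / 2) h (i + 1) (j + 1)" for h i j
  have E4: "of_order (k + 4) E4"
  proof -
    have "of_order (k + 4) (\<lambda>h i j. E (\<theta> * h - h / 2) (h / 2) (\<eta> * h - h / 2) (h / 2) h i j)"
      by (rule E) (use interface_offset assms(6,7) in auto)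
    \<comment> \<open>The shift by zero is written out so that \<open>of_order_shift\<close>
      applies; \<open>add_0_right\<close> removes it afterwards.\<close>
    moreover have "of_order (k + 4)
        (\<lambda>h i j. E (- (h / 2)) (\<theta> * h - h / 2) (\<eta> * h - h / 2) (h / 2) h (i + 1) (j + 0))"
      by (rule of_order_shift, rule E) (use interface_offset assms(6,7) in auto)
    moreover have "of_order (k + 4)
        (\<lambda>h i j. E (\<theta> * h - h / 2) (h / 2) (- (h / 2)) (\<eta> * h - h / 2) h (i + 0) (j + 1))"
      by (rule of_order_shift, rule E) (use interface_offset assms(6,7) in auto)
    moreover have "of_order (k + 4)
        (\<lambda>h i j. E (- (h / 2)) (\<theta> * h - h / 2) (- (h / 2)) (\<eta> * h - h / 2) h (i + 1) (j + 1))"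
      by (rule of_order_shift, rule E) (use interface_offset assms(6,7) in auto)
    ultimately show ?thesis
      unfolding E4_def[abs_def] add_0_right by (intro of_order_add)
  qed

  \<comment> \<open>An exact identity for the reconstruction error\<close>
  have eq: "reconstruction k R h i j \<theta> \<eta> - sliding_avg h h u (shifted_node h i j \<theta> \<eta>)
      = ((\<Sum>l\<in>{l. deg l \<le> k + 1}. 1 / (fact (fst l) * fact (snd l)) * M l h i j) - E4 h i j)
        / (h * h)"
    if h: "h > 0" for h i j
  proof -
    note sp = interface_offset[OF assms(6) h] interface_offset[OF assms(7) h]
    define x1 where "x1 = of_int i * h + (\<theta> * h - h / 2)"
    define x2 where "x2 = of_int i * h + h / 2"
    define x3 where "x3 = of_int i * h + (\<theta> * h + h / 2)"
    define y1 where "y1 = of_int j * h + (\<eta> * h - h / 2)"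
    define y2 where "y2 = of_int j * h + h / 2"
    define y3 where "y3 = of_int j * h + (\<eta> * h + h / 2)"
    \<comment> \<open>The interface and the far end are re-expressed relative to the neighbouring
      node, the centre of the polynomial beyond the interface.\<close>
    have x': "x2 = of_int (i + 1) * h + (- (h / 2))" "x3 = of_int (i + 1) * h + (\<theta> * h - h / 2)"
      and y': "y2 = of_int (j + 1) * h + (- (h / 2))" "y3 = of_int (j + 1) * h + (\<eta> * h - h / 2)"
      by (simp_all add: x2_def x3_def y2_def y3_def distrib_right)
    have ord: "x1 \<le> x2" "x2 \<le> x3" "y1 \<le> y2" "y2 \<le> y3"
      using sp unfolding x1_def x2_def x3_def y1_def y2_def y3_def by linarith+
    define ii where "ii = iterated_integral"
    define L where "L s t = local_poly k R h (if s then i + 1 else i) (if t then j + 1 else j)"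
      for s t
    have xl: "\<bar>x - of_int i * h\<bar> < h / 2" if "x1 < x" "x < x2" for x
      using that sp unfolding x1_def x2_def by linarith
    have xr: "\<bar>x - of_int (i + 1) * h\<bar> < h / 2" if "x2 < x" "x < x3" for x
      using that sp unfolding x' by linarith
    have yl: "\<bar>y - of_int j * h\<bar> < h / 2" if "y1 < y" "y < y2" for y
      using that sp unfolding y1_def y2_def by linarith
    have yr: "\<bar>y - of_int (j + 1) * h\<bar> < h / 2" if "y2 < y" "y < y3" for y
      using that sp unfolding y' by linarith
    have Q: "ii x1 x3 y1 y3 (piecewise_poly k R h)
        = ii x1 x2 y1 y2 (local_poly k R h i j) + ii x2 x3 y1 y2 (local_poly k R h (i + 1) j)
        + ii x1 x2 y2 y3 (local_poly k R h i (j + 1))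
        + ii x2 x3 y2 y3 (local_poly k R h (i + 1) (j + 1))"
      unfolding ii_def
      by (rule iterated_integral_four_pieces[OF ord, of L, unfolded L_def if_True if_False];
          intro continuous_local_poly piecewise_poly_interior h xl xr yl yr)
    have U: "ii x1 x3 y1 y3 u = ii x1 x2 y1 y2 u + ii x2 x3 y1 y2 u + ii x1 x2 y2 y3 u + ii x2 x3 y2 y3 u"
      unfolding ii_def
      by (rule iterated_integral_four_pieces[OF ord, of "\<lambda>_ _. u"]) (simp_all add: smooth_continuous u)
    let ?w = "\<lambda>l. 1 / (fact (fst l) * fact (snd l)) :: real"
    have p1: "ii x1 x2 y1 y2 (local_poly k R h i j) - ii x1 x2 y1 y2 u
        = (\<Sum>l\<in>{l. deg l \<le> k + 1}. ?w l * (moment (fst l) (\<theta> * h - h / 2) (h / 2)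
            * moment (snd l) (\<eta> * h - h / 2) (h / 2) * D l h i j))
          - E (\<theta> * h - h / 2) (h / 2) (\<eta> * h - h / 2) (h / 2) h i j"
      unfolding ii_def x1_def x2_def y1_def y2_def D_def E_def
      by (rule piece_error[OF u]) (use sp in auto)
    have p2: "ii x2 x3 y1 y2 (local_poly k R h (i + 1) j) - ii x2 x3 y1 y2 u
        = (\<Sum>l\<in>{l. deg l \<le> k + 1}. ?w l * (moment (fst l) (- (h / 2)) (\<theta> * h - h / 2)
            * moment (snd l) (\<eta> * h - h / 2) (h / 2) * D l h (i + 1) j))
          - E (- (h / 2)) (\<theta> * h - h / 2) (\<eta> * h - h / 2) (h / 2) h (i + 1) j"
      unfolding ii_def x' y1_def y2_def D_def E_def
      by (rule piece_error[OF u]) (use sp in auto)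
    have p3: "ii x1 x2 y2 y3 (local_poly k R h i (j + 1)) - ii x1 x2 y2 y3 u
        = (\<Sum>l\<in>{l. deg l \<le> k + 1}. ?w l * (moment (fst l) (\<theta> * h - h / 2) (h / 2)
            * moment (snd l) (- (h / 2)) (\<eta> * h - h / 2) * D l h i (j + 1)))
          - E (\<theta> * h - h / 2) (h / 2) (- (h / 2)) (\<eta> * h - h / 2) h i (j + 1)"
      unfolding ii_def x1_def x2_def y' D_def E_def
      by (rule piece_error[OF u]) (use sp in auto)
    have p4: "ii x2 x3 y2 y3 (local_poly k R h (i + 1) (j + 1)) - ii x2 x3 y2 y3 u
        = (\<Sum>l\<in>{l. deg l \<le> k + 1}. ?w l * (moment (fst l) (- (h / 2)) (\<theta> * h - h / 2)
            * moment (snd l) (- (h / 2)) (\<eta> * h - h / 2) * D l h (i + 1) (j + 1)))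
          - E (- (h / 2)) (\<theta> * h - h / 2) (- (h / 2)) (\<eta> * h - h / 2) h (i + 1) (j + 1)"
      unfolding ii_def x' y' D_def E_def
      by (rule piece_error[OF u]) (use sp in auto)
    have "ii x1 x3 y1 y3 (piecewise_poly k R h) - ii x1 x3 y1 y3 u
        = (\<Sum>l\<in>{l. deg l \<le> k + 1}. ?w l * M l h i j) - E4 h i j"
      unfolding M_def E4_def distrib_left sum.distrib using Q U p1 p2 p3 p4 by linarith
    moreover have "sliding_avg h h f (shifted_node h i j \<theta> \<eta>) = ii x1 x3 y1 y3 f / (h * h)" for f
      unfolding shifted_node_def sliding_avg_iterated ii_def x1_def x3_def y1_def y3_def
      by (simp add: add.assoc add_diff_eq)
    ultimately show ?thesis
      unfolding reconstruction_def by (simp flip: diff_divide_distrib)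
  qed

  \<comment> \<open>The order of the total error\<close>
  have k4: "k + 4 = k + 2 + 2" by simp
  have "of_order (k + 4) (\<lambda>h i j. 1 / (fact (fst l) * fact (snd l)) * M l h i j)"
    if "l \<in> {l. deg l \<le> k + 1}" for l
    using of_order_mult[OF of_order_const[of "1 / (fact (fst l) * fact (snd l))"] M[of l]] that by simp
  then have "of_order (k + 2 + 2) (\<lambda>h i j.
      (\<Sum>l\<in>{l. deg l \<le> k + 1}. 1 / (fact (fst l) * fact (snd l)) * M l h i j) - E4 h i j)"
    using E4 unfolding k4 by (intro of_order_diff of_order_sum)
  \<comment> \<open>Averaging divides by the area h^2 and lowers the order from k + 4 to k + 2. The
    identity \<open>eq\<close> holds for h > 0, the range that \<open>of_order_cong\<close> asks
    for.\<close>
  from of_order_cong[OF eq of_order_divide_square[OF this]] show ?thesis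
    by (subst eq_up_to_order_iff_of_order)
qed

end
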